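(* Let $a,b,c,d$ be distinct letters. The semiring $S(abcd)=S(\{abcd\})$ is an eleven-element noncommutative (i.e. with noncommutative multiplication) finitely based flat semiring in the signature $(+,\cdot)$. Hence both of the following assertions are false: (1) for every finite nonempty set $W$ of nonempty words, $S(W)$ is finitely based if and only if all words in $W$ have length at most three; (2) for every nonempty set $W$ of nonempty words, $S(W)$ is finitely based if and only if all words in $W$ have length at most three.
   Context: An ai-semiring is an algebra $(S,+,\cdot)$ in which addition is associative, commutative and idempotent, multiplication is associative, and both distributive laws hold. It is flat if it has a multiplicative zero $0$ and $x+x=x$, $x+y=0$ whenever $x\ne y$. For a nonempty set $W$ of nonempty words over an alphabet, $F(W)$ is the set of all nonempty contiguous factors of words in $W$, and $S(W)=(F(W)\cup\{0\},+,\cdot)$ has flat addition and multiplication: for $u,v\in F(W)$, $u\cdot v$ is the concatenation $uv$ if $uv\in F(W)$ and $0$ otherwise; products involving $0$ are $0$. An algebra is finitely based if all identities valid in it (in the signature $(+,\cdot)$) follow from some finite set of identities valid in it. *)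

theory Defs
  imports "HOL-Library.Sublist"
begin

record 'a algebra =
  alg_carrier :: "'a set"
  alg_add :: "'a \<Rightarrow> 'a \<Rightarrow> 'a"
  alg_mult :: "'a \<Rightarrow> 'a \<Rightarrow> 'a"

definition algebra_closed :: "'a algebra \<Rightarrow> bool" where
  "algebra_closed A \<longleftrightarrow> alg_carrier A \<noteq> {} \<and>
     (\<forall>x\<in>alg_carrier A. \<forall>y\<in>alg_carrier A.
        alg_add A x y \<in> alg_carrier A \<and> alg_mult A x y \<in> alg_carrier A)"

definition ai_semiring :: "'a algebra \<Rightarrow> bool" where
  "ai_semiring A \<longleftrightarrow> algebra_closed A \<and>
     (\<forall>x\<in>alg_carrier A. alg_add A x x = x) \<and>
     (\<forall>x\<in>alg_carrier A. \<forall>y\<in>alg_carrier A. alg_add A x y = alg_add A y x) \<and>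
     (\<forall>x\<in>alg_carrier A. \<forall>y\<in>alg_carrier A. \<forall>z\<in>alg_carrier A.
        alg_add A (alg_add A x y) z = alg_add A x (alg_add A y z) \<and>
        alg_mult A (alg_mult A x y) z = alg_mult A x (alg_mult A y z) \<and>
        alg_mult A x (alg_add A y z) = alg_add A (alg_mult A x y) (alg_mult A x z) \<and>
        alg_mult A (alg_add A x y) z = alg_add A (alg_mult A x z) (alg_mult A y z))"

definition flat_semiring :: "'a algebra \<Rightarrow> bool" where
  "flat_semiring A \<longleftrightarrow> ai_semiring A \<and>
     (\<exists>z\<in>alg_carrier A.
        (\<forall>x\<in>alg_carrier A. alg_mult A x z = z \<and> alg_mult A z x = z) \<and>
        (\<forall>x\<in>alg_carrier A. alg_add A x x = x) \<and>
        (\<forall>x\<in>alg_carrier A. \<forall>y\<in>alg_carrier A. x \<noteq> y \<longrightarrow> alg_add A x y = z))"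

definition mult_commutative :: "'a algebra \<Rightarrow> bool" where
  "mult_commutative A \<longleftrightarrow>
     (\<forall>x\<in>alg_carrier A. \<forall>y\<in>alg_carrier A. alg_mult A x y = alg_mult A y x)"


datatype trm = Var nat | Add trm trm | Mult trm trm

fun trm_eval :: "'a algebra \<Rightarrow> (nat \<Rightarrow> 'a) \<Rightarrow> trm \<Rightarrow> 'a" where
  "trm_eval A v (Var n) = v n"
| "trm_eval A v (Add s t) = alg_add A (trm_eval A v s) (trm_eval A v t)"
| "trm_eval A v (Mult s t) = alg_mult A (trm_eval A v s) (trm_eval A v t)"

fun trm_subst :: "(nat \<Rightarrow> trm) \<Rightarrow> trm \<Rightarrow> trm" where
  "trm_subst \<sigma> (Var n) = \<sigma> n"
| "trm_subst \<sigma> (Add s t) = Add (trm_subst \<sigma> s) (trm_subst \<sigma> t)"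
| "trm_subst \<sigma> (Mult s t) = Mult (trm_subst \<sigma> s) (trm_subst \<sigma> t)"

definition satisfies :: "'a algebra \<Rightarrow> trm \<times> trm \<Rightarrow> bool" where
  "satisfies A e \<longleftrightarrow>
     (\<forall>v. range v \<subseteq> alg_carrier A \<longrightarrow> trm_eval A v (fst e) = trm_eval A v (snd e))"

text \<open>Equational consequence is given by Birkhoff's calculus, since HOL cannot quantify over
  algebras on all types inside a definition. The lemmas \<open>eq_derives_sound\<close> and
  \<open>eq_derives_complete\<close> below show that it agrees with semantic consequence.\<close>

inductive eq_derives :: "(trm \<times> trm) set \<Rightarrow> trm \<Rightarrow> trm \<Rightarrow> bool" for E where
  eq_ax: "(s, t) \<in> E \<Longrightarrow> eq_derives E (trm_subst \<sigma> s) (trm_subst \<sigma> t)"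
| eq_refl: "eq_derives E t t"
| eq_sym: "eq_derives E s t \<Longrightarrow> eq_derives E t s"
| eq_trans: "eq_derives E s t \<Longrightarrow> eq_derives E t u \<Longrightarrow> eq_derives E s u"
| eq_add: "eq_derives E s s' \<Longrightarrow> eq_derives E t t' \<Longrightarrow> eq_derives E (Add s t) (Add s' t')"
| eq_mult: "eq_derives E s s' \<Longrightarrow> eq_derives E t t' \<Longrightarrow> eq_derives E (Mult s t) (Mult s' t')"

definition finitely_based :: "'a algebra \<Rightarrow> bool" where
  "finitely_based A \<longleftrightarrow>
     (\<exists>E. finite E \<and> (\<forall>e\<in>E. satisfies A e) \<and>
          (\<forall>s t. satisfies A (s, t) \<longrightarrow> eq_derives E s t))"

lemma trm_eval_closed:
  assumes "algebra_closed A" "range v \<subseteq> alg_carrier A"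
  shows "trm_eval A v t \<in> alg_carrier A"
  using assms by (induction t) (auto simp: algebra_closed_def)

lemma trm_eval_subst: "trm_eval A v (trm_subst \<sigma> t) = trm_eval A (\<lambda>n. trm_eval A v (\<sigma> n)) t"
  by (induction t) auto

lemma eq_derives_sound:
  assumes "eq_derives E s t" "algebra_closed A" "\<forall>e\<in>E. satisfies A e"
  shows "satisfies A (s, t)"
  using assms(1)
proof (induction rule: eq_derives.induct)
  case (eq_ax s t \<sigma>)
  show ?case
    unfolding satisfies_def
  proof (intro allI impI)
    fix v :: "nat \<Rightarrow> 'a" assume v: "range v \<subseteq> alg_carrier A"
    have "range (\<lambda>n. trm_eval A v (\<sigma> n)) \<subseteq> alg_carrier A"
      using trm_eval_closed[OF assms(2) v] by auto
    then show "trm_eval A v (fst (trm_subst \<sigma> s, trm_subst \<sigma> t)) =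
        trm_eval A v (snd (trm_subst \<sigma> s, trm_subst \<sigma> t))"
      using assms(3) eq_ax unfolding satisfies_def by (fastforce simp: trm_eval_subst)
  qed
qed (auto simp: satisfies_def)

lemma eq_derives_complete:
  assumes "\<And>A :: trm algebra.
      algebra_closed A \<Longrightarrow> \<forall>e\<in>E. satisfies A e \<Longrightarrow> satisfies A (s, t)"
  shows "eq_derives E s t"
proof -
  define rep where "rep t = (SOME u. eq_derives E t u)" for t
  have rep: "eq_derives E t (rep t)" for t
    unfolding rep_def by (rule someI[of _ t]) (rule eq_refl)
  have rep_eqI: "rep t = rep u" if "eq_derives E t u" for t u
  proof -
    have "eq_derives E t = eq_derives E u"
      using that by (intro ext) (blast intro: eq_sym eq_trans)
    then show ?thesis by (simp add: rep_def)
  qed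
  define A where "A = \<lparr>alg_carrier = range rep, alg_add = (\<lambda>x y. rep (Add x y)),
    alg_mult = (\<lambda>x y. rep (Mult x y))\<rparr>"
  have closed: "algebra_closed A"
    by (auto simp: algebra_closed_def A_def)
  have eval: "trm_eval A (\<lambda>n. rep (\<sigma> n)) t = rep (trm_subst \<sigma> t)" for \<sigma> t
  proof (induction t)
    case (Add t u)
    then show ?case
      by (auto simp: A_def intro!: rep_eqI eq_add intro: eq_sym rep)
  next
    case (Mult t u)
    then show ?case
      by (auto simp: A_def intro!: rep_eqI eq_mult intro: eq_sym rep)
  qed simp
  have "satisfies A e" if e: "e \<in> E" for e
    unfolding satisfies_def
  proof (intro allI impI)
    fix v :: "nat \<Rightarrow> trm" assume "range v \<subseteq> alg_carrier A"
    then have "\<forall>n. \<exists>u::trm. v n = rep u" by (auto simp: A_def)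
    then obtain \<sigma> :: "nat \<Rightarrow> trm" where \<sigma>: "v = (\<lambda>n. rep (\<sigma> n))" by metis
    have "eq_derives E (trm_subst \<sigma> (fst e)) (trm_subst \<sigma> (snd e))"
      using e by (intro eq_ax) simp
    then show "trm_eval A v (fst e) = trm_eval A v (snd e)"
      unfolding \<sigma> eval by (rule rep_eqI)
  qed
  then have "satisfies A (s, t)" using assms closed by blast
  moreover have "range (\<lambda>n. rep (Var n)) \<subseteq> alg_carrier A" by (auto simp: A_def)
  ultimately have "rep (trm_subst Var s) = rep (trm_subst Var t)"
    unfolding satisfies_def using eval[of Var] by fastforce
  moreover have "trm_subst Var t = t" for t by (induction t) auto
  ultimately have "rep s = rep t" by simp
  then show ?thesis using rep[of s] rep[of t] by (metis eq_sym eq_trans)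
qed


definition factors :: "'a list set \<Rightarrow> 'a list set" where
  "factors W = {u. u \<noteq> [] \<and> (\<exists>w\<in>W. sublist u w)}"

text \<open>The zero of \<open>S(W)\<close> is \<open>None\<close>; a factor \<open>u\<close> is the element \<open>Some u\<close>.\<close>

definition word_mult :: "'a list set \<Rightarrow> 'a list option \<Rightarrow> 'a list option \<Rightarrow> 'a list option" where
  "word_mult W x y = (case (x, y) of
      (Some u, Some v) \<Rightarrow> if u @ v \<in> factors W then Some (u @ v) else None
    | _ \<Rightarrow> None)"

definition word_semiring :: "'a list set \<Rightarrow> 'a list option algebra" where
  "word_semiring W =
     \<lparr>alg_carrier = insert None (Some ` factors W),
      alg_add = (\<lambda>x y. if x = y then x else None),
      alg_mult = word_mult W\<rparr>"

end

theory Submission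
  imports Defs
begin

text \<open>Distributivity reduces an identity \<open>s \<approx> t\<close> to inequalities \<open>s \<ge> q\<close> with \<open>q\<close> a word of \<open>t\<close>.
  Let \<open>n\<close> be the length of the word \<open>w\<close>, whose letters are distinct, and let \<open>C\<close> be the set of
  words \<open>q\<close> for which \<open>s \<ge> q\<close> follows from the valid identities of bounded size. If \<open>C\<close>
  contains a word longer than \<open>n\<close>, then \<open>s\<close> is derivably zero. Otherwise \<open>C\<close> is closed under
  every valid inference \<open>p + p' + p'' \<ge> q\<close>, since such an inference has bounded size. Three of them
  suffice: exchanging the suffixes after a common letter, completing a rectangle
  \<open>pr, p'r, p'r' \<mapsto> pr'\<close>, and exchanging the suffixes of two words of length \<open>n\<close> at the same
  position. With these closure properties, any \<open>q \<notin> C\<close> is refuted by an assignment that sends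
  each letter to a segment of \<open>w\<close>.\<close>

section \<open>Terms as sets of words\<close>

fun trm_words :: "trm \<Rightarrow> nat list set" where
  "trm_words (Var n) = {[n]}"
| "trm_words (Add s t) = trm_words s \<union> trm_words t"
| "trm_words (Mult s t) = {p @ q | p q. p \<in> trm_words s \<and> q \<in> trm_words t}"

text \<open>The value on the empty list is junk.\<close>

fun word_trm :: "nat list \<Rightarrow> trm" where
  "word_trm [] = Var 0"
| "word_trm [x] = Var x"
| "word_trm (x # y # p) = Mult (Var x) (word_trm (y # p))"

lemma word_trm_Cons: "p \<noteq> [] \<Longrightarrow> word_trm (x # p) = Mult (Var x) (word_trm p)"
  by (cases p) auto

lemma trm_words_nonempty: "trm_words t \<noteq> {}"
  by (induction t) auto

lemma trm_words_not_Nil: "p \<in> trm_words t \<Longrightarrow> p \<noteq> []"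
  by (induction t arbitrary: p) auto

lemma trm_words_word_trm: "p \<noteq> [] \<Longrightarrow> trm_words (word_trm p) = {p}"
  by (induction p rule: word_trm.induct) auto

section \<open>Variables and sizes of terms\<close>

fun trm_vars :: "trm \<Rightarrow> nat set" where
  "trm_vars (Var n) = {n}"
| "trm_vars (Add s t) = trm_vars s \<union> trm_vars t"
| "trm_vars (Mult s t) = trm_vars s \<union> trm_vars t"

fun leaves :: "trm \<Rightarrow> nat" where
  "leaves (Var n) = 1"
| "leaves (Add s t) = leaves s + leaves t"
| "leaves (Mult s t) = leaves s + leaves t"

lemma leaves_pos: "0 < leaves t"
  by (induction t) auto

lemma leaves_word_trm: "p \<noteq> [] \<Longrightarrow> leaves (word_trm p) = length p"
  by (induction p rule: word_trm.induct) auto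

lemma trm_vars_word_trm: "p \<noteq> [] \<Longrightarrow> trm_vars (word_trm p) = set p"
  by (induction p rule: word_trm.induct) auto

lemma finite_trm_vars: "finite (trm_vars t)"
  by (induction t) auto

lemma card_trm_vars: "card (trm_vars t) \<le> leaves t"
  by (induction t) (auto intro: order.trans[OF card_Un_le])

text \<open>Every term has a leaf, so both immediate subterms of a composite term have strictly
  fewer leaves than the term.\<close>

lemma finite_trms:
  assumes "finite V"
  shows "finite {t. leaves t \<le> n \<and> trm_vars t \<subseteq> V}"
proof (induction n)
  case 0
  then show ?case by (simp add: leaves_pos[THEN gr_implies_not0])
next
  case (Suc n)
  let ?T = "{t. leaves t \<le> n \<and> trm_vars t \<subseteq> V}"
  have "t \<in> Var ` V \<union> (\<lambda>(s, t). Add s t) ` (?T \<times> ?T) \<union> (\<lambda>(s, t). Mult s t) ` (?T \<times> ?T)"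
    if "leaves t \<le> Suc n" "trm_vars t \<subseteq> V" for t
  proof (cases t)
    case (Add s u)
    then show ?thesis
      using that leaves_pos[of s] leaves_pos[of u] by auto
  next
    case (Mult s u)
    then show ?thesis
      using that leaves_pos[of s] leaves_pos[of u] by auto
  qed (use that in auto)
  then have "{t. leaves t \<le> Suc n \<and> trm_vars t \<subseteq> V} \<subseteq>
      Var ` V \<union> (\<lambda>(s, t). Add s t) ` (?T \<times> ?T) \<union> (\<lambda>(s, t). Mult s t) ` (?T \<times> ?T)"
    by blast
  then show ?case
    by (rule finite_subset) (simp add: Suc assms)
qed

lemma trm_subst_cong: "(\<And>x. x \<in> trm_vars t \<Longrightarrow> \<sigma> x = \<tau> x) \<Longrightarrow> trm_subst \<sigma> t = trm_subst \<tau> t"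
  by (induction t) auto

lemma trm_subst_Var: "trm_subst Var t = t"
  by (induction t) auto

lemma trm_subst_trm_subst: "trm_subst \<sigma> (trm_subst \<tau> t) = trm_subst (\<lambda>n. trm_subst \<sigma> (\<tau> n)) t"
  by (induction t) auto

lemma leaves_rename: "leaves (trm_subst (\<lambda>n. Var (g n)) t) = leaves t"
  by (induction t) auto

lemma trm_vars_rename: "trm_vars (trm_subst (\<lambda>n. Var (g n)) t) = g ` trm_vars t"
  by (induction t) auto

lemma eq_derives_subst:
  "eq_derives E s t \<Longrightarrow> eq_derives E (trm_subst \<sigma> s) (trm_subst \<sigma> t)"
proof (induction rule: eq_derives.induct)
  case (eq_ax s t \<tau>)
  then show ?case by (simp add: trm_subst_trm_subst eq_derives.eq_ax)
qed (auto intro: eq_derives.intros)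


section \<open>The identities of bounded size\<close>

text \<open>Two terms with at most \<open>N\<close> leaves each have at most \<open>2 * N\<close>
  variables between them, so up to renaming every valid identity of this size is listed.\<close>

definition small_identities :: "'a algebra \<Rightarrow> nat \<Rightarrow> (trm \<times> trm) set" where
  "small_identities A N = {(s, t). satisfies A (s, t) \<and> leaves s \<le> N \<and> leaves t \<le> N \<and>
     trm_vars s \<subseteq> {..<2 * N} \<and> trm_vars t \<subseteq> {..<2 * N}}"

lemma finite_small_identities: "finite (small_identities A N)"
proof -
  let ?T = "{t. leaves t \<le> N \<and> trm_vars t \<subseteq> {..<2 * N}}"
  have "small_identities A N \<subseteq> ?T \<times> ?T"
    by (auto simp: small_identities_def)
  then show ?thesis
    using finite_trms[of "{..<2 * N}" N] by (meson finite_SigmaI finite_lessThan finite_subset)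
qed

text \<open>The lower bound on \<open>N\<close> makes room for the ai-semiring laws, the longest of
  which are the distributive laws with four leaves on one side.\<close>

locale small_basis =
  fixes A :: "'a algebra" and N :: nat
  assumes ai: "ai_semiring A" and N: "6 \<le> N"
begin

abbreviation eqv :: "trm \<Rightarrow> trm \<Rightarrow> bool" (infix "\<cong>" 50) where
  "s \<cong> t \<equiv> eq_derives (small_identities A N) s t"

text \<open>The semilattice order modulo the small identities. Validity of the identity in a flat
  semiring means that \<open>u\<close> takes the value of \<open>s\<close> wherever \<open>s\<close>
  is nonzero.\<close>

definition below :: "trm \<Rightarrow> trm \<Rightarrow> bool" (infix "\<sqsubseteq>" 50) where
  "u \<sqsubseteq> s \<longleftrightarrow> s \<cong> Add s u"

declare eq_trans [trans]

text \<open>An injective renaming moves the variables into the range allowed by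
  \<open>small_identities\<close>; substituting its inverse recovers the original identity.\<close>

lemma eqv_small:
  assumes sat: "satisfies A (s, t)" and size: "leaves s \<le> N" "leaves t \<le> N"
  shows "s \<cong> t"
proof -
  let ?X = "trm_vars s \<union> trm_vars t"
  have "card ?X \<le> card {..<2 * N}"
    using card_Un_le[of "trm_vars s" "trm_vars t"] card_trm_vars[of s] card_trm_vars[of t] size
    by simp
  then obtain g where g: "g ` ?X \<subseteq> {..<2 * N}" "inj_on g ?X"
    using card_le_inj[of ?X "{..<2 * N}"] by (auto simp: finite_trm_vars)
  let ?s = "trm_subst (\<lambda>n. Var (g n)) s" and ?t = "trm_subst (\<lambda>n. Var (g n)) t"
  have "satisfies A (?s, ?t)"
    unfolding satisfies_def
  proof (intro allI impI)
    fix v :: "nat \<Rightarrow> 'a" assume "range v \<subseteq> alg_carrier A"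
    then have "range (\<lambda>n. v (g n)) \<subseteq> alg_carrier A" by auto
    then show "trm_eval A v (fst (?s, ?t)) = trm_eval A v (snd (?s, ?t))"
      using sat by (simp add: satisfies_def trm_eval_subst)
  qed
  then have "(?s, ?t) \<in> small_identities A N"
    using g size by (auto simp: small_identities_def leaves_rename trm_vars_rename)
  then have "trm_subst (\<lambda>m. Var (inv_into ?X g m)) ?s \<cong> trm_subst (\<lambda>m. Var (inv_into ?X g m)) ?t"
    by (rule eq_ax)
  moreover have "trm_subst (\<lambda>m. Var (inv_into ?X g m)) (trm_subst (\<lambda>n. Var (g n)) u) = u"
    if "trm_vars u \<subseteq> ?X" for u
  proof -
    have "trm_subst (\<lambda>n. Var (inv_into ?X g (g n))) u = trm_subst Var u"
      using that g(2) by (intro trm_subst_cong) (auto simp: inv_into_f_f)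
    then show ?thesis by (simp add: trm_subst_trm_subst trm_subst_Var)
  qed
  ultimately show ?thesis by simp
qed

lemma eqv_small_subst:
  assumes "satisfies A (s, t)" "leaves s \<le> N" "leaves t \<le> N"
  shows "trm_subst \<sigma> s \<cong> trm_subst \<sigma> t"
  using assms by (intro eq_derives_subst eqv_small)

section \<open>The ai-semiring laws as derivable identities\<close>

lemma add_assoc: "Add (Add x y) z \<cong> Add x (Add y z)"
  using eqv_small_subst[of "Add (Add (Var 0) (Var 1)) (Var 2)" "Add (Var 0) (Add (Var 1) (Var 2))"
      "\<lambda>i. [x, y, z] ! i"] ai N
  by (simp add: satisfies_def ai_semiring_def image_subset_iff)

lemma add_commute: "Add x y \<cong> Add y x"
  using eqv_small_subst[of "Add (Var 0) (Var 1)" "Add (Var 1) (Var 0)" "\<lambda>i. [x, y] ! i"] ai N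
  by (simp add: satisfies_def ai_semiring_def image_subset_iff)

lemma add_idem: "x \<cong> Add x x"
  using eqv_small_subst[of "Var 0" "Add (Var 0) (Var 0)" "\<lambda>i. x"] ai N
  by (simp add: satisfies_def ai_semiring_def image_subset_iff)

lemma mult_assoc: "Mult (Mult x y) z \<cong> Mult x (Mult y z)"
  using eqv_small_subst[of "Mult (Mult (Var 0) (Var 1)) (Var 2)" "Mult (Var 0) (Mult (Var 1) (Var 2))"
      "\<lambda>i. [x, y, z] ! i"] ai N
  by (simp add: satisfies_def ai_semiring_def image_subset_iff)

lemma distrib_left: "Mult x (Add y z) \<cong> Add (Mult x y) (Mult x z)"
  using eqv_small_subst[of "Mult (Var 0) (Add (Var 1) (Var 2))"
      "Add (Mult (Var 0) (Var 1)) (Mult (Var 0) (Var 2))" "\<lambda>i. [x, y, z] ! i"] ai N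
  by (simp add: satisfies_def ai_semiring_def image_subset_iff)

lemma distrib_right: "Mult (Add x y) z \<cong> Add (Mult x z) (Mult y z)"
  using eqv_small_subst[of "Mult (Add (Var 0) (Var 1)) (Var 2)"
      "Add (Mult (Var 0) (Var 2)) (Mult (Var 1) (Var 2))" "\<lambda>i. [x, y, z] ! i"] ai N
  by (simp add: satisfies_def ai_semiring_def image_subset_iff)

section \<open>The derivable order\<close>

lemma below_refl: "x \<sqsubseteq> x"
  unfolding below_def by (rule add_idem)

lemma below_cong: "u \<sqsubseteq> s \<Longrightarrow> u \<cong> u' \<Longrightarrow> u' \<sqsubseteq> s"
  unfolding below_def by (rule eq_trans[OF _ eq_add[OF eq_refl]])

lemma below_cong_right: "u \<sqsubseteq> s \<Longrightarrow> s \<cong> s' \<Longrightarrow> u \<sqsubseteq> s'"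
  unfolding below_def by (rule eq_trans[OF eq_sym eq_trans[OF _ eq_add[OF _ eq_refl]]])

lemma below_Add:
  assumes "u \<sqsubseteq> s" "v \<sqsubseteq> s"
  shows "Add u v \<sqsubseteq> s"
proof -
  have "s \<cong> Add s v" using assms(2) by (simp add: below_def)
  also have "Add s v \<cong> Add (Add s u) v"
    using assms(1) by (intro eq_add eq_refl) (simp add: below_def)
  also have "\<dots> \<cong> Add s (Add u v)" by (rule add_assoc)
  finally show ?thesis by (simp add: below_def)
qed

lemma below_Add2:
  assumes "u \<sqsubseteq> t"
  shows "u \<sqsubseteq> Add s t"
proof -
  have "Add s t \<cong> Add s (Add t u)"
    using assms by (intro eq_add eq_refl) (simp add: below_def)
  also have "\<dots> \<cong> Add (Add s t) u" by (rule eq_sym[OF add_assoc])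
  finally show ?thesis by (simp add: below_def)
qed

lemma below_Add1: "u \<sqsubseteq> s \<Longrightarrow> u \<sqsubseteq> Add s t"
  by (rule below_cong_right[OF below_Add2 add_commute])

text \<open>\<open>u\<close> is below \<open>Add s v\<close>, which is equivalent to
  \<open>s\<close>.\<close>

lemma below_trans: "u \<sqsubseteq> v \<Longrightarrow> v \<sqsubseteq> s \<Longrightarrow> u \<sqsubseteq> s"
  using below_cong_right[OF below_Add2 eq_sym] unfolding below_def .

lemma below_antisym: "s \<sqsubseteq> t \<Longrightarrow> t \<sqsubseteq> s \<Longrightarrow> s \<cong> t"
  unfolding below_def by (rule eq_trans[OF _ eq_trans[OF add_commute eq_sym]])

text \<open>By distributivity \<open>Mult u v\<close> is a summand of
  \<open>Mult (Add s u) (Add t v)\<close>, which the hypotheses turn into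
  \<open>Mult s t\<close>.\<close>

lemma below_Mult:
  assumes "u \<sqsubseteq> s" "v \<sqsubseteq> t"
  shows "Mult u v \<sqsubseteq> Mult s t"
proof -
  have "Mult u v \<sqsubseteq> Mult u (Add t v)"
    by (rule below_cong_right[OF below_Add2[OF below_refl] eq_sym[OF distrib_left]])
  then have "Mult u v \<sqsubseteq> Mult (Add s u) (Add t v)"
    by (rule below_cong_right[OF below_Add2 eq_sym[OF distrib_right]])
  moreover have "Mult (Add s u) (Add t v) \<cong> Mult s t"
    using assms unfolding below_def by (rule eq_mult[OF eq_sym eq_sym])
  ultimately show ?thesis by (rule below_cong_right)
qed

section \<open>Reduction of terms to their words\<close>

lemma word_trm_append:
  "p \<noteq> [] \<Longrightarrow> q \<noteq> [] \<Longrightarrow> Mult (word_trm p) (word_trm q) \<cong> word_trm (p @ q)"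
proof (induction p rule: word_trm.induct)
  case (2 x)
  then show ?case by (simp add: word_trm_Cons eq_refl)
next
  case (3 x y p)
  then have "Mult (word_trm (y # p)) (word_trm q) \<cong> word_trm (y # p @ q)"
    by simp
  then show ?case
    using eq_trans[OF mult_assoc eq_mult[OF eq_refl]] by simp
qed simp

text \<open>Half of the fact that a term is derivably the sum of its words; the other half is
  \<open>below_words\<close>.\<close>

lemma word_below: "p \<in> trm_words s \<Longrightarrow> word_trm p \<sqsubseteq> s"
proof (induction s arbitrary: p)
  case (Var n)
  then show ?case by (simp add: below_refl)
next
  case (Add s t)
  then show ?case by (metis UnE below_Add1 below_Add2 trm_words.simps(2))
next
  case (Mult s t)
  then obtain q r where q: "p = q @ r" "q \<in> trm_words s" "r \<in> trm_words t" by auto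
  have "Mult (word_trm q) (word_trm r) \<sqsubseteq> Mult s t"
    using Mult.IH q by (intro below_Mult)
  moreover have "Mult (word_trm q) (word_trm r) \<cong> word_trm (q @ r)"
    by (rule word_trm_append[OF trm_words_not_Nil[OF q(2)] trm_words_not_Nil[OF q(3)]])
  ultimately show ?case
    unfolding q(1) by (rule below_cong)
qed

text \<open>The additive map \<open>F\<close> ranges over multiplication contexts, which grow in the induction.\<close>

lemma context_below:
  assumes cong: "\<And>x y. x \<cong> y \<Longrightarrow> F x \<cong> F y"
    and add: "\<And>x y. F (Add x y) \<cong> Add (F x) (F y)"
    and words: "\<And>p. p \<in> trm_words t \<Longrightarrow> F (word_trm p) \<sqsubseteq> s"
  shows "F t \<sqsubseteq> s"
  using assms
proof (induction t arbitrary: F)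
  case (Var n)
  show ?case using Var.prems(3)[of "[n]"] by simp
next
  case (Add t u)
  have "F t \<sqsubseteq> s"
    by (rule Add.IH(1)[OF Add.prems(1,2) Add.prems(3)]) simp_all
  moreover have "F u \<sqsubseteq> s"
    by (rule Add.IH(2)[OF Add.prems(1,2) Add.prems(3)]) simp_all
  ultimately have "Add (F t) (F u) \<sqsubseteq> s"
    by (rule below_Add)
  then show ?case
    by (rule below_cong) (rule eq_sym, rule Add.prems(2))
next
  case (Mult t u)
  show ?case
  proof (rule Mult.IH(1)[of "\<lambda>x. F (Mult x u)"])
    fix p assume p: "p \<in> trm_words t"
    show "F (Mult (word_trm p) u) \<sqsubseteq> s"
    proof (rule Mult.IH(2)[of "\<lambda>x. F (Mult (word_trm p) x)"])
      fix q assume q: "q \<in> trm_words u"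
      have "F (word_trm (p @ q)) \<sqsubseteq> s"
        by (rule Mult.prems(3)) (use p q in auto)
      moreover have "word_trm (p @ q) \<cong> Mult (word_trm p) (word_trm q)"
        by (rule eq_sym[OF word_trm_append[OF trm_words_not_Nil[OF p] trm_words_not_Nil[OF q]]])
      then have "F (word_trm (p @ q)) \<cong> F (Mult (word_trm p) (word_trm q))"
        by (rule Mult.prems(1))
      ultimately show "F (Mult (word_trm p) (word_trm q)) \<sqsubseteq> s" by (rule below_cong)
    next
      fix x y assume "x \<cong> y"
      then show "F (Mult (word_trm p) x) \<cong> F (Mult (word_trm p) y)"
        by (rule Mult.prems(1)[OF eq_mult[OF eq_refl]])
    next
      fix x y
      show "F (Mult (word_trm p) (Add x y)) \<cong> Add (F (Mult (word_trm p) x)) (F (Mult (word_trm p) y))"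
        by (rule eq_trans[OF Mult.prems(1)[OF distrib_left] Mult.prems(2)])
    qed
  next
    fix x y assume "x \<cong> y"
    then show "F (Mult x u) \<cong> F (Mult y u)"
      by (rule Mult.prems(1)[OF eq_mult[OF _ eq_refl]])
  next
    fix x y
    show "F (Mult (Add x y) u) \<cong> Add (F (Mult x u)) (F (Mult y u))"
      by (rule eq_trans[OF Mult.prems(1)[OF distrib_right] Mult.prems(2)])
  qed
qed

lemma below_words: "(\<And>p. p \<in> trm_words t \<Longrightarrow> word_trm p \<sqsubseteq> s) \<Longrightarrow> t \<sqsubseteq> s"
  by (rule context_below[of "\<lambda>x. x", OF _ eq_refl])

end


section \<open>Evaluation in the semiring of a set of words\<close>

lemma factors_append:
  assumes "u @ v \<in> factors W"
  shows "u \<noteq> [] \<Longrightarrow> u \<in> factors W" "v \<noteq> [] \<Longrightarrow> v \<in> factors W"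
proof -
  obtain w where w: "w \<in> W" "sublist (u @ v) w"
    using assms by (auto simp: factors_def)
  have "sublist u w" "sublist v w"
    using w(2) sublist_order.order.trans sublist_appendI sublist_append_leftI
      sublist_append_rightI by blast+
  then show "u \<noteq> [] \<Longrightarrow> u \<in> factors W" "v \<noteq> [] \<Longrightarrow> v \<in> factors W"
    using w(1) by (auto simp: factors_def)
qed

lemma Nil_notin_factors: "[] \<notin> factors W"
  by (simp add: factors_def)

lemma word_mult_None: "word_mult W None x = None" "word_mult W x None = None"
  by (auto simp: word_mult_def split: option.split)

lemma word_mult_Some: "word_mult W (Some u) (Some v) = (if u @ v \<in> factors W then Some (u @ v) else None)"
  by (simp add: word_mult_def)

lemma word_mult_eq_Some:
  "word_mult W x y = Some w \<longleftrightarrow> (\<exists>u v. x = Some u \<and> y = Some v \<and> w = u @ v \<and> w \<in> factors W)"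
  by (auto simp: word_mult_def split: option.splits)

text \<open>Both sides are nonzero exactly when the whole concatenation is a factor, since nonempty
  pieces of a factor are factors. Membership of \<open>x\<close> and \<open>z\<close> in the carrier
  excludes \<open>Some []\<close>, so the inner products are nonempty.\<close>

lemma word_mult_assoc:
  assumes "x \<in> alg_carrier (word_semiring W)" "z \<in> alg_carrier (word_semiring W)"
  shows "word_mult W (word_mult W x y) z = word_mult W x (word_mult W y z)"
proof -
  have "word_mult W (word_mult W x y) z = Some w \<longleftrightarrow> word_mult W x (word_mult W y z) = Some w" for w
  proof
    assume "word_mult W (word_mult W x y) z = Some w"
    then obtain u v t where uvt: "x = Some u" "y = Some v" "z = Some t" "w = u @ v @ t" "w \<in> factors W"
      by (auto simp: word_mult_eq_Some)
    moreover have "t \<noteq> []" using assms uvt Nil_notin_factors by (auto simp: word_semiring_def)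
    ultimately show "word_mult W x (word_mult W y z) = Some w"
      using factors_append(2)[of u "v @ t" W] by (simp add: word_mult_eq_Some)
  next
    assume "word_mult W x (word_mult W y z) = Some w"
    then obtain u v t where uvt: "x = Some u" "y = Some v" "z = Some t" "w = u @ v @ t" "w \<in> factors W"
      by (auto simp: word_mult_eq_Some)
    moreover have "u \<noteq> []" using assms uvt Nil_notin_factors by (auto simp: word_semiring_def)
    ultimately show "word_mult W (word_mult W x y) z = Some w"
      using factors_append(1)[of "u @ v" t W] by (simp add: word_mult_eq_Some)
  qed
  then show ?thesis by (metis not_Some_eq)
qed

text \<open>Distributivity is the cancellation \<open>uv = uv' \<noteq> 0 \<Longrightarrow> v = v'\<close>.\<close>

lemma flat_semiring_word_semiring: "flat_semiring (word_semiring W)"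
proof -
  have closed: "word_mult W x y \<in> alg_carrier (word_semiring W)" for x y
  proof (cases "word_mult W x y")
    case (Some w)
    then show ?thesis by (auto simp: word_mult_eq_Some word_semiring_def)
  qed (simp add: word_semiring_def)
  have cancel: "word_mult W x y = None" if "word_mult W x y = word_mult W x z" "y \<noteq> z" for x y z
  proof (rule ccontr)
    assume "word_mult W x y \<noteq> None"
    then obtain w where w: "word_mult W x y = Some w" by blast
    with that(1) have "word_mult W x z = Some w" by simp
    with w that(2) show False by (auto simp: word_mult_eq_Some)
  qed
  have cancel': "word_mult W x z = None" if "word_mult W x z = word_mult W y z" "x \<noteq> y" for x y z
  proof (rule ccontr)
    assume "word_mult W x z \<noteq> None"
    then obtain w where w: "word_mult W x z = Some w" by blast
    with that(1) have "word_mult W y z = Some w" by simp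
    with w that(2) show False by (auto simp: word_mult_eq_Some)
  qed
  let ?add = "\<lambda>x y. if x = y then x else None :: 'a list option"
  have dist: "word_mult W x (?add y z) = ?add (word_mult W x y) (word_mult W x z)" for x y z
    using cancel[of x y z] by (cases "y = z") (auto simp: word_mult_None)
  have dist': "word_mult W (?add x y) z = ?add (word_mult W x z) (word_mult W y z)" for x y z
    using cancel'[of x z y] by (cases "x = y") (auto simp: word_mult_None)
  have "ai_semiring (word_semiring W)"
    unfolding ai_semiring_def
  proof (intro conjI ballI)
    show "algebra_closed (word_semiring W)"
      unfolding algebra_closed_def using closed by (simp add: word_semiring_def)
  next
    fix x y z
    assume "x \<in> alg_carrier (word_semiring W)" "z \<in> alg_carrier (word_semiring W)"
    then show "alg_mult (word_semiring W) (alg_mult (word_semiring W) x y) z =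
        alg_mult (word_semiring W) x (alg_mult (word_semiring W) y z)"
      using word_mult_assoc by (simp add: word_semiring_def)
  next
    fix x y z
    show "alg_mult (word_semiring W) x (alg_add (word_semiring W) y z) =
        alg_add (word_semiring W) (alg_mult (word_semiring W) x y) (alg_mult (word_semiring W) x z)"
      using dist by (simp add: word_semiring_def)
    show "alg_mult (word_semiring W) (alg_add (word_semiring W) x y) z =
        alg_add (word_semiring W) (alg_mult (word_semiring W) x z) (alg_mult (word_semiring W) y z)"
      using dist' by (simp add: word_semiring_def)
  qed (simp_all add: word_semiring_def)
  moreover have "None \<in> alg_carrier (word_semiring W)"
    by (simp add: word_semiring_def)
  ultimately show ?thesis
    unfolding flat_semiring_def by (auto intro!: bexI[of _ None] simp: word_semiring_def word_mult_None)
qed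

text \<open>The product of the letter values as plain concatenation; that the result is a factor is
  demanded separately. Unlike iterated \<open>word_mult\<close>, it splits at any position and makes
  sense for the empty list.\<close>

definition spells :: "(nat \<Rightarrow> 'a list option) \<Rightarrow> nat list \<Rightarrow> 'a list \<Rightarrow> bool" where
  "spells v p w \<longleftrightarrow> None \<notin> v ` set p \<and> concat (map (\<lambda>x. the (v x)) p) = w"

lemma spells_append:
  "spells v (p @ q) w \<longleftrightarrow> (\<exists>t u. spells v p t \<and> spells v q u \<and> w = t @ u)"
  by (auto simp: spells_def)

lemma spells_Cons: "spells v (x # q) w \<longleftrightarrow> (\<exists>t u. v x = Some t \<and> spells v q u \<and> w = t @ u)"
  by (auto simp: spells_def)

lemma spells_Nil: "spells v [] w \<longleftrightarrow> w = []"
  by (auto simp: spells_def)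

lemma spells_unique: "spells v p w \<Longrightarrow> spells v p w' \<Longrightarrow> w = w'"
  by (auto simp: spells_def)

text \<open>Nonzero elements are nonempty words, so each letter contributes at least one
  symbol.\<close>

lemma length_spells:
  assumes "range v \<subseteq> alg_carrier (word_semiring W)" "spells v p w"
  shows "length p \<le> length w"
  using assms(2)
proof (induction p arbitrary: w)
  case (Cons x p)
  then obtain t u where tu: "v x = Some t" "spells v p u" "w = t @ u"
    by (auto simp: spells_Cons)
  then have "Some t \<in> alg_carrier (word_semiring W)"
    using assms(1) by (metis rangeI subsetD)
  then have "t \<noteq> []"
    using Nil_notin_factors by (auto simp: word_semiring_def)
  then have "1 \<le> length t" by (cases t) auto
  then show ?case using Cons.IH[OF tu(2)] tu(3) by simp
qed simp

text \<open>A flat sum is nonzero only if its summands agree, so all words of \<open>t\<close> must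
  spell the same factor. For a product, one word of each side fixes how \<open>w\<close> splits, and
  cancellation forces this split on all other words.\<close>

lemma trm_eval_eq_Some:
  assumes v: "range v \<subseteq> alg_carrier (word_semiring W)"
  shows "trm_eval (word_semiring W) v t = Some w \<longleftrightarrow>
    w \<in> factors W \<and> (\<forall>p\<in>trm_words t. spells v p w)"
proof (induction t arbitrary: w)
  case (Var n)
  have "v n \<in> alg_carrier (word_semiring W)" using v by auto
  then show ?case by (auto simp: spells_def word_semiring_def)
next
  case (Add s t)
  have "trm_eval (word_semiring W) v (Add s t) = Some w \<longleftrightarrow>
      trm_eval (word_semiring W) v s = Some w \<and> trm_eval (word_semiring W) v t = Some w"
    by (auto simp: word_semiring_def)
  then show ?case using Add by auto
next
  case (Mult s t)
  have "trm_eval (word_semiring W) v (Mult s t) = Some w \<longleftrightarrow>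
      (\<exists>u u'. trm_eval (word_semiring W) v s = Some u \<and> trm_eval (word_semiring W) v t = Some u' \<and>
         w = u @ u' \<and> w \<in> factors W)"
    by (simp add: word_mult_eq_Some word_semiring_def)
  also have "\<dots> \<longleftrightarrow> w \<in> factors W \<and> (\<forall>p\<in>trm_words (Mult s t). spells v p w)"
  proof
    assume "\<exists>u u'. trm_eval (word_semiring W) v s = Some u \<and>
      trm_eval (word_semiring W) v t = Some u' \<and> w = u @ u' \<and> w \<in> factors W"
    then obtain u u' where u: "\<forall>p\<in>trm_words s. spells v p u" "\<forall>p\<in>trm_words t. spells v p u'"
        and w: "w = u @ u'" "w \<in> factors W"
      unfolding Mult.IH by blast
    have "spells v (p @ q) w" if "p \<in> trm_words s" "q \<in> trm_words t" for p q
      unfolding spells_append using u w(1) that by blast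
    then show "w \<in> factors W \<and> (\<forall>p\<in>trm_words (Mult s t). spells v p w)"
      using w(2) by auto
  next
    assume w: "w \<in> factors W \<and> (\<forall>p\<in>trm_words (Mult s t). spells v p w)"
    obtain p q where pq: "p \<in> trm_words s" "q \<in> trm_words t"
      using trm_words_nonempty by (meson all_not_in_conv)
    have spells: "spells v (p @ q) w" if "p \<in> trm_words s" "q \<in> trm_words t" for p q
    proof -
      have "p @ q \<in> trm_words (Mult s t)" using that by auto
      then show ?thesis using w by blast
    qed
    obtain u u' where u: "spells v p u" "spells v q u'" "w = u @ u'"
      using spells[OF pq] unfolding spells_append by blast
    \<comment> \<open>Paired with the fixed \<open>q\<close>, which spells \<open>u'\<close>, the
      word \<open>p'\<close> is left with \<open>u\<close>.\<close>
    have "spells v p' u" if p': "p' \<in> trm_words s" for p'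
    proof -
      obtain z z' where "spells v p' z" "spells v q z'" "w = z @ z'"
        using spells[OF p' pq(2)] unfolding spells_append by blast
      then show ?thesis
        using u(3) spells_unique[OF u(2), of z'] by simp
    qed
    moreover have "spells v q' u'" if q': "q' \<in> trm_words t" for q'
    proof -
      obtain z z' where "spells v p z" "spells v q' z'" "w = z @ z'"
        using spells[OF pq(1) q'] unfolding spells_append by blast
      then show ?thesis
        using u(3) spells_unique[OF u(1), of z] by simp
    qed
    moreover have "u \<noteq> []" "u' \<noteq> []"
      using length_spells[OF v u(1)] length_spells[OF v u(2)]
        trm_words_not_Nil[OF pq(1)] trm_words_not_Nil[OF pq(2)] by auto
    then have "u \<in> factors W" "u' \<in> factors W"
      using w u(3) factors_append[of u u' W] by simp_all
    ultimately have "trm_eval (word_semiring W) v s = Some u" "trm_eval (word_semiring W) v t = Some u'"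
      unfolding Mult.IH by simp_all
    then show "\<exists>u u'. trm_eval (word_semiring W) v s = Some u \<and>
        trm_eval (word_semiring W) v t = Some u' \<and> w = u @ u' \<and> w \<in> factors W"
      using w u(3) by blast
  qed
  finally show ?case .
qed


section \<open>Separating the nodes of a closed set of words\<close>

text \<open>The words of \<open>C\<close> are the paths from source to sink in an acyclic graph with one edge per
  letter. Its nodes are represented by the left quotients of \<open>C\<close>, as in the minimal automaton. A
  labeling of the nodes by \<open>0, \<dots>, n\<close> that increases along edges yields an assignment. Two
  nodes that are not separated by the labelings below lie at the same distance from the source on
  paths of maximal length \<open>n\<close>, and are then equal by \<open>exchange\<close>.\<close>

locale path_system =
  fixes C :: "nat list set" and n :: nat
  assumes length_le: "p \<in> C \<Longrightarrow> length p \<le> n"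
    and letter: "p @ x # r \<in> C \<Longrightarrow> p' @ x # r' \<in> C \<Longrightarrow> p @ x # r' \<in> C"
    and rectangle: "p @ r \<in> C \<Longrightarrow> p' @ r \<in> C \<Longrightarrow> p' @ r' \<in> C \<Longrightarrow> p @ r' \<in> C"
    and exchange: "p @ r \<in> C \<Longrightarrow> p' @ r' \<in> C \<Longrightarrow> length p = length p' \<Longrightarrow>
      length (p @ r) = n \<Longrightarrow> length (p' @ r') = n \<Longrightarrow> p @ r' \<in> C"
begin

definition node :: "nat list \<Rightarrow> nat list set" where
  "node p = {r. p @ r \<in> C}"

text \<open>The length of a longest path from the source to \<open>k\<close>: no labeling by
  naturals that increases along edges can label \<open>k\<close> lower.\<close>

definition early :: "nat list set \<Rightarrow> nat" where
  "early k = Max (length ` {p. node p = k})"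

text \<open>The elements of \<open>k\<close> are the paths from \<open>k\<close> to the sink, so
  this is the highest label that leaves room up to \<open>n\<close> for the longest of them.\<close>

definition late :: "nat list set \<Rightarrow> nat" where
  "late k = n - Max (length ` k)"

text \<open>A path spelling \<open>r\<close> leads from \<open>k\<close> to \<open>k'\<close>; the
  empty \<open>r\<close> makes every node reach itself.\<close>

definition reach :: "nat list set \<Rightarrow> nat list set \<Rightarrow> bool" where
  "reach k k' \<longleftrightarrow> (\<exists>r. {t. r @ t \<in> k} = k')"

text \<open>Nodes reachable from \<open>u\<close> are pushed as high as possible, all others as low
  as possible. Labels still increase along edges, because no edge leaves the reachable part and
  \<open>early\<close> is at most \<open>late\<close>.\<close>

definition level :: "nat list set \<Rightarrow> nat list set \<Rightarrow> nat" where
  "level u k = (if reach u k then late k else early k)"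

text \<open>The tail of the edge labeled \<open>x\<close>. By \<open>letter\<close>, all occurrences
  of \<open>x\<close> in \<open>C\<close> give the same node.\<close>

definition start :: "nat \<Rightarrow> nat list set" where
  "start x = node (SOME p. \<exists>r. p @ x # r \<in> C)"

definition stop :: "nat \<Rightarrow> nat list set" where
  "stop x = node ((SOME p. \<exists>r. p @ x # r \<in> C) @ [x])"

lemma in_node: "r \<in> node p \<longleftrightarrow> p @ r \<in> C"
  by (simp add: node_def)

lemma node_append: "node (p @ r) = {t. r @ t \<in> node p}"
  by (simp add: node_def)

lemma node_append_cong: "node p = node p' \<Longrightarrow> node (p @ r) = node (p' @ r)"
  by (simp add: node_append)

text \<open>Given one common continuation, \<open>rectangle\<close> carries every continuation of
  one prefix over to the other.\<close>

lemma node_eqI: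
  assumes "r \<in> node p" "r \<in> node p'"
  shows "node p = node p'"
proof -
  have "t \<in> node p'" if "r \<in> node p" "r \<in> node p'" "t \<in> node p" for p p' t
    using rectangle[of p' r p t] that by (simp add: in_node)
  then show ?thesis using assms by blast
qed

lemma start_stop:
  assumes "p @ x # r \<in> C"
  shows "start x = node p" "stop x = node (p @ [x])"
proof -
  let ?p = "SOME p. \<exists>r. p @ x # r \<in> C"
  have "\<exists>r. ?p @ x # r \<in> C"
    by (rule someI[of "\<lambda>p. \<exists>r. p @ x # r \<in> C" p]) (rule exI, rule assms)
  then obtain r' where "?p @ x # r' \<in> C" ..
  then have "x # r' \<in> node ?p" "x # r' \<in> node p"
    using letter[OF assms, of ?p r'] by (simp_all add: in_node)
  then have "node ?p = node p" by (rule node_eqI)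
  then show "start x = node p" "stop x = node (p @ [x])"
    using node_append_cong[of ?p p "[x]"] by (simp_all only: start_def stop_def)
qed

text \<open>All lengths involved are at most \<open>n\<close>, so the maxima in \<open>early\<close>
  and \<open>late\<close> range over finite nonempty sets and are attained.\<close>

lemma bounds:
  assumes "r \<in> node p"
  shows "length r \<le> Max (length ` node p)" "Max (length ` node p) \<le> n"
    "length p \<le> early (node p)" "\<exists>p'. node p' = node p \<and> length p' = early (node p)"
    "\<exists>r'. r' \<in> node p \<and> length r' = Max (length ` node p)"
proof -
  have "length r \<le> n" if "r \<in> node p" for r
    using length_le[of "p @ r"] that by (simp add: in_node)
  then have "length ` node p \<subseteq> {..n}" by auto
  then have fin: "finite (length ` node p)" by (rule finite_subset) simp
  show "length r \<le> Max (length ` node p)"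
    by (rule Max_ge[OF fin imageI[OF assms]])
  have ne: "length ` node p \<noteq> {}" using assms by auto
  show "\<exists>r'. r' \<in> node p \<and> length r' = Max (length ` node p)"
    using imageE[OF Max_in[OF fin ne]] by metis
  show "Max (length ` node p) \<le> n"
    using \<open>length ` node p \<subseteq> {..n}\<close> Max_in[OF fin ne] by blast
  have "length p' \<le> n" if "node p' = node p" for p'
  proof -
    have "p' @ r \<in> C" using assms unfolding that[symmetric] in_node .
    then show ?thesis using length_le[of "p' @ r"] by simp
  qed
  then have "length ` {p'. node p' = node p} \<subseteq> {..n}" by auto
  then have fin': "finite (length ` {p'. node p' = node p})" by (rule finite_subset) simp
  show "length p \<le> early (node p)"
    unfolding early_def by (rule Max_ge[OF fin']) simp
  have "early (node p) \<in> length ` {p'. node p' = node p}"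
    unfolding early_def by (rule Max_in[OF fin']) auto
  then show "\<exists>p'. node p' = node p \<and> length p' = early (node p)" by (elim imageE) auto
qed

text \<open>A longest path to the node followed by a longest path from it is a word of
  \<open>C\<close>, hence has length at most \<open>n\<close>.\<close>

lemma early_le_late:
  assumes "r \<in> node p"
  shows "early (node p) \<le> late (node p)"
proof -
  obtain p' where p': "node p' = node p" "length p' = early (node p)"
    using bounds(4)[OF assms] by blast
  obtain r' where r': "r' \<in> node p" "length r' = Max (length ` node p)"
    using bounds(5)[OF assms] by blast
  have "p' @ r' \<in> C" using r'(1) unfolding p'(1)[symmetric] in_node .
  then show ?thesis
    using length_le[of "p' @ r'"] p'(2) r'(2) by (simp add: late_def)
qed

lemma early_less:
  assumes "q \<noteq> []" "r \<in> node (p @ q)"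
  shows "early (node p) < early (node (p @ q))"
proof -
  have "q @ r \<in> node p" using assms by (simp add: node_def)
  then obtain p' where p': "node p' = node p" "length p' = early (node p)"
    using bounds(4) by blast
  have eq: "node (p' @ q) = node (p @ q)" by (rule node_append_cong[OF p'(1)])
  have "length (p' @ q) \<le> early (node (p @ q))"
    using bounds(3)[of r "p' @ q"] assms(2) unfolding eq .
  then show ?thesis
    using p'(2) assms(1) by (simp flip: length_greater_0_conv)
qed

lemma late_less:
  assumes "q \<noteq> []" "r \<in> node (p @ q)"
  shows "late (node p) < late (node (p @ q))"
proof -
  obtain r' where r': "r' \<in> node (p @ q)" "length r' = Max (length ` node (p @ q))"
    using bounds(5)[OF assms(2)] by blast
  then have "q @ r' \<in> node p" by (simp add: node_def)
  \<comment> \<open>The bound by \<open>n\<close> keeps the truncated subtraction in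
    \<open>late\<close> strictly monotone here.\<close>
  then have "length (q @ r') \<le> Max (length ` node p)" "Max (length ` node p) \<le> n"
    by (rule bounds)+
  then show ?thesis using r'(2) assms(1) by (simp add: late_def flip: length_greater_0_conv)
qed

lemma level_less:
  assumes "q \<noteq> []" "r \<in> node (p @ q)"
  shows "level u (node p) < level u (node (p @ q))"
proof -
  have "reach u (node (p @ q))" if "reach u (node p)"
  proof -
    obtain s where "node p = {t. s @ t \<in> u}"
      using \<open>reach u (node p)\<close> by (auto simp: reach_def)
    then have "{t. (s @ q) @ t \<in> u} = node (p @ q)"
      by (simp add: node_append)
    then show ?thesis unfolding reach_def by blast
  qed
  moreover have "early (node p) \<le> late (node p)"
    by (rule early_le_late[of "q @ r"]) (use assms in \<open>simp add: node_def\<close>)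
  ultimately show ?thesis
    using early_less[OF assms] late_less[OF assms] by (auto simp: level_def)
qed

text \<open>\<open>[]\<close> continues \<open>p\<close>. A nonempty continuation \<open>r\<close>
  would close a cycle, as \<open>node (p @ r)\<close> contains \<open>[]\<close> too, and
  \<open>early_less\<close> forbids cycles. So \<open>node p\<close> is the sink
  \<open>{[]}\<close>, which is reachable from every nonempty node and receives its late label
  \<open>n\<close>.\<close>

lemma level_node:
  assumes "p \<in> C" "s \<in> node u"
  shows "level (node u) (node p) = n"
proof -
  have Nil: "[] \<in> node p" using assms(1) by (simp add: node_def)
  have "node p = {[]}"
  proof (rule ccontr)
    assume "node p \<noteq> {[]}"
    then obtain r where r: "r \<in> node p" "r \<noteq> []" using Nil by auto
    then have "[] \<in> node (p @ r)" by (simp add: node_def)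
    then have "node (p @ r) = node p" using Nil by (intro node_eqI)
    then show False using early_less[OF r(2) \<open>[] \<in> node (p @ r)\<close>] by simp
  qed
  then have "late (node p) = n" by (simp add: late_def)
  moreover have "[] \<in> node (u @ s)" using assms(2) by (simp add: node_def)
  then have "node (u @ s) = node p" using Nil by (intro node_eqI)
  then have "reach (node u) (node p)" unfolding reach_def node_append by blast
  ultimately show ?thesis by (simp add: level_def)
qed

text \<open>In the labeling attached to \<open>node p\<close>, that node has its late label. Were
  \<open>node p'\<close> reachable from it, its label would be strictly larger; so
  \<open>node p'\<close> has its early label.\<close>

lemma late_eq_early:
  assumes "r \<in> node p" "r' \<in> node p'" "level (node p) (node p) = level (node p) (node p')"
    "node p \<noteq> node p'"
  shows "late (node p) = early (node p')"
proof -
  have refl: "reach (node p) (node p)"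
    unfolding reach_def by (rule exI[of _ "[]"]) simp
  have "\<not> reach (node p) (node p')"
  proof
    assume "reach (node p) (node p')"
    then obtain q where "{t. q @ t \<in> node p} = node p'" unfolding reach_def ..
    then have q: "node p' = node (p @ q)" by (simp only: node_append)
    have "q \<noteq> []" using assms(4) q by (metis append_Nil2)
    then have "level (node p) (node p) < level (node p) (node p')"
      using level_less[of q r' p "node p"] assms(2) q by simp
    then show False using assms(3) by simp
  qed
  then show ?thesis using assms(3) refl by (simp add: level_def)
qed

lemma node_eq:
  assumes "r \<in> node p" "r' \<in> node p'"
    "\<And>u s. s \<in> node u \<Longrightarrow> level (node u) (node p) = level (node u) (node p')"
  shows "node p = node p'"
proof (rule ccontr)
  assume neq: "node p \<noteq> node p'"
  have "late (node p) = early (node p')"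
    by (rule late_eq_early[OF assms(1,2) assms(3)[OF assms(1)] neq])
  moreover have "late (node p') = early (node p)"
    by (rule late_eq_early[OF assms(2,1) assms(3)[OF assms(2), symmetric] neq[symmetric]])
  \<comment> \<open>Since \<open>early\<close> is at most \<open>late\<close>, the two equations
    force all four numbers to coincide.\<close>
  ultimately have eq: "early (node p) = early (node p')" "late (node p) = early (node p)"
      "late (node p') = early (node p)"
    using early_le_late[OF assms(1)] early_le_late[OF assms(2)] by auto
  obtain q where q: "node q = node p" "length q = early (node p)"
    using bounds(4)[OF assms(1)] by blast
  obtain s where s: "s \<in> node p" "length s = Max (length ` node p)"
    using bounds(5)[OF assms(1)] by blast
  obtain q' where q': "node q' = node p'" "length q' = early (node p')"
    using bounds(4)[OF assms(2)] by blast
  obtain s' where s': "s' \<in> node p'" "length s' = Max (length ` node p')"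
    using bounds(5)[OF assms(2)] by blast
  \<comment> \<open>For each node, \<open>early\<close> equals \<open>late\<close>, so a longest
    path to it and a longest path from it form a word of length exactly \<open>n\<close>.\<close>
  have "q @ s' \<in> C"
  proof (rule exchange)
    show "q @ s \<in> C" using s(1) unfolding q(1)[symmetric] in_node .
    show "q' @ s' \<in> C" using s'(1) unfolding q'(1)[symmetric] in_node .
    show "length q = length q'" using q(2) q'(2) eq(1) by simp
    show "length (q @ s) = n"
      using q(2) s(2) eq(2) bounds(2)[OF assms(1)] by (simp add: late_def)
    show "length (q' @ s') = n"
      using q'(2) s'(2) eq(1,3) bounds(2)[OF assms(2)] by (simp add: late_def)
  qed
  then have "s' \<in> node p" unfolding in_node[symmetric] q(1) .
  then show False using node_eqI[OF _ s'(1)] neq by simp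
qed

end

text \<open>The intervals from \<open>S x\<close> to \<open>T x\<close>, for the letters
  \<open>x\<close> of the list in order, laid end to end from \<open>i\<close> to
  \<open>j\<close>.\<close>

fun chain :: "(nat \<Rightarrow> nat) \<Rightarrow> (nat \<Rightarrow> nat) \<Rightarrow> nat \<Rightarrow> nat list \<Rightarrow> nat \<Rightarrow> bool" where
  "chain S T i [] j \<longleftrightarrow> i = j"
| "chain S T i (x # q) j \<longleftrightarrow> S x = i \<and> chain S T (T x) q j"

context path_system
begin

lemma chain_node:
  assumes "r \<in> node p" "s \<in> node u"
  shows "chain (\<lambda>x. level (node u) (start x)) (\<lambda>x. level (node u) (stop x)) (level (node u) (node p)) r n"
  using assms(1)
proof (induction r arbitrary: p)
  case Nil
  then show ?case using level_node[OF _ assms(2)] by (simp add: node_def)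
next
  case (Cons x r)
  then have "p @ x # r \<in> C" "r \<in> node (p @ [x])" by (auto simp: node_def)
  then show ?case using Cons.IH[of "p @ [x]"] by (simp add: start_stop)
qed

text \<open>Under every labeling the edge of the next letter starts at the label of the current
  node, so by \<open>node_eq\<close> it starts at that node. When the letters run out, the current
  node has label \<open>n\<close> throughout, as the sink does, and hence is the sink.\<close>

lemma node_chain:
  assumes "r \<in> node p" "\<And>x. x \<in> set q \<Longrightarrow> \<exists>p r. p @ x # r \<in> C"
    and "\<And>u s. s \<in> node u \<Longrightarrow> chain (\<lambda>x. level (node u) (start x)) (\<lambda>x. level (node u) (stop x))
        (level (node u) (node p)) q n"
  shows "q \<in> node p"
  using assms
proof (induction q arbitrary: p r)
  case Nil
  have C: "p @ r \<in> C" using Nil.prems(1) unfolding in_node .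
  then have r: "[] \<in> node (p @ r)" by (simp add: in_node)
  have "node p = node (p @ r)"
  proof (rule node_eq[OF Nil.prems(1) r])
    show "level (node u) (node p) = level (node u) (node (p @ r))" if "s \<in> node u" for u s
      using Nil.prems(3)[OF that] level_node[OF C that] by simp
  qed
  then show ?case using r by simp
next
  case (Cons y q)
  obtain p0 r0 where C: "p0 @ y # r0 \<in> C" using Cons.prems(2) by (meson list.set_intros(1))
  have "node p0 = node p"
  proof (rule node_eq)
    show "y # r0 \<in> node p0" using C unfolding in_node .
    show "r \<in> node p" by (rule Cons.prems(1))
    show "level (node u) (node p0) = level (node u) (node p)" if "s \<in> node u" for u s
      using Cons.prems(3)[OF that] start_stop(1)[OF C] by simp
  qed
  then have C': "p @ y # r0 \<in> C" using C unfolding in_node[symmetric] by simp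
  have "q \<in> node (p @ [y])"
  proof (rule Cons.IH)
    show "r0 \<in> node (p @ [y])" using C' by (simp add: in_node)
    show "\<exists>p r. p @ x # r \<in> C" if "x \<in> set q" for x
      using Cons.prems(2) that by auto
    show "chain (\<lambda>x. level (node u) (start x)) (\<lambda>x. level (node u) (stop x))
        (level (node u) (node (p @ [y]))) q n" if "s \<in> node u" for u s
      using Cons.prems(3)[OF that] start_stop(2)[OF C'] by simp
  qed
  then show ?case by (simp add: in_node)
qed

end

section \<open>Segments of a word with distinct letters\<close>

definition slice :: "'a list \<Rightarrow> nat \<Rightarrow> nat \<Rightarrow> 'a list" where
  "slice w i j = drop i (take j w)"

lemma length_slice: "j \<le> length w \<Longrightarrow> length (slice w i j) = j - i"
  by (simp add: slice_def)

lemma slice_append: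
  assumes "i \<le> j" "j \<le> k" "k \<le> length w"
  shows "slice w i j @ slice w j k = slice w i k"
proof -
  have "take k w = take j w @ drop j (take k w)"
    using append_take_drop_id[of j "take k w"] assms by (simp add: min_def)
  then have "drop i (take k w) = drop i (take j w @ drop j (take k w))" by (rule arg_cong)
  then show ?thesis using assms by (simp add: slice_def)
qed

lemma slice_Cons: "i < j \<Longrightarrow> j \<le> length w \<Longrightarrow> slice w i j = w ! i # slice w (Suc i) j"
  unfolding slice_def by (subst Cons_nth_drop_Suc[symmetric]) auto

lemma chain_le: "chain S T i q j \<Longrightarrow> (\<And>x. x \<in> set q \<Longrightarrow> S x < T x) \<Longrightarrow> i \<le> j"
proof (induction q arbitrary: i)
  case (Cons x q)
  then have "T x \<le> j" "S x = i" "S x < T x" by auto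
  then show ?case by simp
qed simp

text \<open>In a word without repeated letters a nonempty segment determines where it begins, so the
  first segment can be located and cancelled.\<close>

lemma concat_slices:
  assumes "distinct w" "\<And>x. x \<in> set q \<Longrightarrow> S x < T x \<and> T x \<le> length w" "i \<le> j" "j \<le> length w"
  shows "concat (map (\<lambda>x. slice w (S x) (T x)) q) = slice w i j \<longleftrightarrow> chain S T i q j"
  using assms(2,3)
proof (induction q arbitrary: i)
  case Nil
  have "slice w i j = [] \<longleftrightarrow> i = j"
    using length_slice[OF assms(4), of i] Nil(2) by (auto simp flip: length_0_conv)
  then show ?case by auto
next
  case (Cons x q)
  have x: "S x < T x" "T x \<le> length w" using Cons.prems(1) by auto
  have IH: "concat (map (\<lambda>x. slice w (S x) (T x)) q) = slice w (T x) j \<longleftrightarrow> chain S T (T x) q j"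
    if "T x \<le> j"
    by (rule Cons.IH) (use Cons.prems(1) that in auto)
  show ?case
  proof
    assume "chain S T i (x # q) j"
    then have chain: "S x = i" "chain S T (T x) q j" by auto
    have le: "T x \<le> j" using chain_le[OF chain(2)] Cons.prems(1) by auto
    then have "concat (map (\<lambda>x. slice w (S x) (T x)) q) = slice w (T x) j" using IH chain(2) by simp
    then show "concat (map (\<lambda>x. slice w (S x) (T x)) (x # q)) = slice w i j"
      using slice_append[of i "T x" j w] x chain(1) le assms(4) by simp
  next
    assume "concat (map (\<lambda>x. slice w (S x) (T x)) (x # q)) = slice w i j"
    then have eq: "slice w (S x) (T x) @ concat (map (\<lambda>x. slice w (S x) (T x)) q) = slice w i j"
      by simp
    have "length (slice w (S x) (T x) @ concat (map (\<lambda>x. slice w (S x) (T x)) q)) = j - i"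
      unfolding eq by (rule length_slice[OF assms(4)])
    then have "T x - S x \<le> j - i" using length_slice[OF x(2), of "S x"] by simp
    then have "i < j" "i < length w" using x assms(4) by auto
    \<comment> \<open>Both sides are nonempty, so their first letters can be compared.\<close>
    then have "w ! S x = w ! i"
      using eq slice_Cons[OF x] slice_Cons[OF \<open>i < j\<close> assms(4)] by simp
    then have i: "S x = i"
      using nth_eq_iff_index_eq[OF assms(1), of "S x" i] x \<open>i < length w\<close> by simp
    then have le: "T x \<le> j" using \<open>T x - S x \<le> j - i\<close> x by simp
    have "slice w i (T x) @ concat (map (\<lambda>x. slice w (S x) (T x)) q) = slice w i (T x) @ slice w (T x) j"
      using eq slice_append[of i "T x" j w] x i le assms(4) by simp
    then have "chain S T (T x) q j" using IH[OF le] by simp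
    then show "chain S T i (x # q) j" using i by simp
  qed
qed

lemma slice_in_factors: "i < j \<Longrightarrow> j \<le> length w \<Longrightarrow> slice w i j \<in> factors {w}"
  by (auto simp: factors_def slice_def intro: sublist_order.order.trans[OF sublist_drop sublist_take])

section \<open>Assignments obtained from labelings\<close>

context path_system
begin

text \<open>Each letter of \<open>C\<close> goes to the segment between the labels of the ends of
  its edge. Letters foreign to \<open>C\<close> go to zero, which refutes every word containing
  one.\<close>

definition assignment :: "'a list \<Rightarrow> nat list set \<Rightarrow> nat \<Rightarrow> 'a list option" where
  "assignment w u x = (if \<exists>p r. p @ x # r \<in> C
     then Some (slice w (level u (start x)) (level u (stop x))) else None)"

lemma level_le: "r \<in> node p \<Longrightarrow> level u (node p) \<le> n"
  using early_le_late[of r p] by (auto simp: level_def late_def)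

lemma level_start_less_stop:
  assumes "p @ x # r \<in> C"
  shows "level u (start x) < level u (stop x)" "level u (stop x) \<le> n"
proof -
  have "r \<in> node (p @ [x])" using assms by (simp add: in_node)
  then show "level u (start x) < level u (stop x)" "level u (stop x) \<le> n"
    unfolding start_stop[OF assms] by (auto intro: level_less level_le)
qed

lemma range_assignment:
  assumes "length w = n"
  shows "range (assignment w u) \<subseteq> alg_carrier (word_semiring {w})"
  using level_start_less_stop assms
  by (auto simp: assignment_def word_semiring_def intro!: imageI slice_in_factors)

lemma spells_assignment:
  assumes "distinct w" "length w = n" "r \<in> C"
  shows "spells (assignment w u) q (slice w (level u (node [])) n) \<longleftrightarrow>
    (\<forall>x\<in>set q. \<exists>p r. p @ x # r \<in> C) \<and>
    chain (\<lambda>x. level u (start x)) (\<lambda>x. level u (stop x)) (level u (node [])) q n"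
proof (cases "\<forall>x\<in>set q. \<exists>p r. p @ x # r \<in> C")
  case True
  have "map (\<lambda>x. the (assignment w u x)) q = map (\<lambda>x. slice w (level u (start x)) (level u (stop x))) q"
    using True by (simp add: assignment_def)
  moreover have "concat (map (\<lambda>x. slice w (level u (start x)) (level u (stop x))) q) =
      slice w (level u (node [])) n \<longleftrightarrow>
      chain (\<lambda>x. level u (start x)) (\<lambda>x. level u (stop x)) (level u (node [])) q n"
  proof (rule concat_slices[OF assms(1)])
    show "level u (start x) < level u (stop x) \<and> level u (stop x) \<le> length w" if "x \<in> set q" for x
      using True that level_start_less_stop assms(2) by blast
    show "level u (node []) \<le> n" by (rule level_le[of r]) (simp add: in_node assms(3))
  qed (simp add: assms(2))
  moreover have "None \<notin> assignment w u ` set q"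
    using True by (auto simp: assignment_def)
  ultimately show ?thesis using True unfolding spells_def by metis
next
  case False
  then have "None \<in> assignment w u ` set q"
    by (force simp: assignment_def image_iff)
  then show ?thesis using False by (simp add: spells_def)
qed

lemma spells_assignment_mem:
  assumes "distinct w" "length w = n" "p \<in> C" "s \<in> node u"
  shows "spells (assignment w (node u)) p (slice w (level (node u) (node [])) n)"
proof -
  have "\<exists>p' r. p' @ x # r \<in> C" if "x \<in> set p" for x
    using split_list[OF that] assms(3) by metis
  moreover have "p \<in> node []" using assms(3) by (simp add: in_node)
  ultimately show ?thesis
    unfolding spells_assignment[OF assms(1-3)] using chain_node assms(4) by blast
qed

text \<open>In contrapositive form, a word outside \<open>C\<close> misses the common value of the
  words of \<open>C\<close> under one of the labelings.\<close>

lemma memI_spells: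
  assumes "distinct w" "length w = n" "r \<in> C"
    and spells: "\<And>u s. s \<in> node u \<Longrightarrow>
      spells (assignment w (node u)) q (slice w (level (node u) (node [])) n)"
  shows "q \<in> C"
proof -
  have r: "r \<in> node []" using assms(3) by (simp add: in_node)
  have "q \<in> node []"
  proof (rule node_chain[OF r])
    show "\<exists>p r. p @ x # r \<in> C" if "x \<in> set q" for x
      using spells[OF r] that unfolding spells_assignment[OF assms(1-3)] by blast
    show "chain (\<lambda>x. level (node u) (start x)) (\<lambda>x. level (node u) (stop x))
        (level (node u) (node [])) q n" if "s \<in> node u" for u s
      using spells[OF that] unfolding spells_assignment[OF assms(1-3)] by blast
  qed
  then show ?thesis by (simp add: in_node)
qed

end

section \<open>A word without repeated letters\<close>

text \<open>Zero absorbs every summand, and adding \<open>t\<close> preserves a nonzero value only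
  if \<open>t\<close> has the same value.\<close>

lemma satisfies_Add:
  "satisfies (word_semiring W) (s, Add s t) \<longleftrightarrow>
    (\<forall>v z. range v \<subseteq> alg_carrier (word_semiring W) \<longrightarrow> trm_eval (word_semiring W) v s = Some z \<longrightarrow>
       trm_eval (word_semiring W) v t = Some z)"
proof -
  have "trm_eval (word_semiring W) v s = trm_eval (word_semiring W) v (Add s t) \<longleftrightarrow>
      (\<forall>z. trm_eval (word_semiring W) v s = Some z \<longrightarrow> trm_eval (word_semiring W) v t = Some z)" for v
    by (cases "trm_eval (word_semiring W) v s") (auto simp: word_semiring_def)
  then show ?thesis unfolding satisfies_def fst_conv snd_conv by blast
qed

text \<open>The first letter of \<open>X\<close> occurs only once in the whole word, which fixes the
  position of \<open>X\<close>.\<close>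

lemma distinct_middle_unique:
  assumes "distinct (P @ X @ R)" "P @ X @ R = P' @ X @ R'" "X \<noteq> []"
  shows "P = P'" "R = R'"
proof -
  obtain a Y where X: "X = a # Y" using assms(3) by (cases X) auto
  have "distinct (P' @ X @ R')" using assms(1,2) by simp
  then have "P @ a # (Y @ R) = P' @ a # (Y @ R') \<longleftrightarrow> P = P' \<and> Y @ R = Y @ R'"
    using assms(1) by (intro append_Cons_eq_iff) (auto simp: X)
  then show "P = P'" "R = R'" using assms(2) by (auto simp: X)
qed

locale linear_word =
  fixes w :: "'a list"
  assumes distinct: "distinct w" and nonempty: "w \<noteq> []"

text \<open>The largest inference used has three premises of length at most \<open>length w\<close>
  and a conclusion of length at most \<open>2 * length w\<close>; the summand 6 serves the
  ai-semiring laws.\<close>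

sublocale linear_word \<subseteq> small_basis "word_semiring {w}" "6 * length w + 6"
  using flat_semiring_word_semiring[of "{w}"] by unfold_locales (auto simp: flat_semiring_def)

context linear_word
begin

notation eqv (infix "\<cong>" 50)
notation below (infix "\<sqsubseteq>" 50)

lemma length_pos: "0 < length w"
  using nonempty by simp

lemma factor_distinct: "z \<in> factors {w} \<Longrightarrow> distinct z"
  and length_factor: "z \<in> factors {w} \<Longrightarrow> length z \<le> length w"
  using distinct by (auto simp: factors_def sublist_def)

text \<open>Three premises are what the rectangle rule takes; the rules with two premises repeat
  one. A conclusion made of a prefix and a suffix of premises has length at most
  \<open>2 * length w\<close>.\<close>

lemma below_consequence:
  assumes below: "word_trm p1 \<sqsubseteq> s" "word_trm p2 \<sqsubseteq> s" "word_trm p3 \<sqsubseteq> s"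
    and ne: "p1 \<noteq> []" "p2 \<noteq> []" "p3 \<noteq> []" "q \<noteq> []"
    and len: "length p1 \<le> length w" "length p2 \<le> length w" "length p3 \<le> length w"
      "length q \<le> 2 * length w"
    and spells: "\<And>v z. range v \<subseteq> alg_carrier (word_semiring {w}) \<Longrightarrow> z \<in> factors {w} \<Longrightarrow>
      spells v p1 z \<Longrightarrow> spells v p2 z \<Longrightarrow> spells v p3 z \<Longrightarrow> spells v q z"
  shows "word_trm q \<sqsubseteq> s"
proof (rule below_trans)
  let ?P = "Add (Add (word_trm p1) (word_trm p2)) (word_trm p3)"
  show "?P \<sqsubseteq> s" by (intro below_Add below)
  have "satisfies (word_semiring {w}) (?P, Add ?P (word_trm q))"
    unfolding satisfies_Add
  proof (intro allI impI)
    fix v z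
    assume v: "range v \<subseteq> alg_carrier (word_semiring {w})"
      and "trm_eval (word_semiring {w}) v ?P = Some z"
    then show "trm_eval (word_semiring {w}) v (word_trm q) = Some z"
      using spells[OF v] ne unfolding trm_eval_eq_Some[OF v] by (simp add: trm_words_word_trm)
  qed
  then show "word_trm q \<sqsubseteq> ?P"
    unfolding below_def using ne len by (intro eqv_small) (auto simp: leaves_word_trm)
qed

text \<open>A product of more than \<open>length w\<close> elements is zero, so everything lies
  below it. To keep the identity small, only a prefix of length \<open>length w\<close> is written
  out; the variable \<open>x\<close> stands for the rest of \<open>p\<close>, however long, and
  \<open>y\<close> for \<open>u\<close>.\<close>

lemma below_long:
  assumes long: "length w < length p" and p: "word_trm p \<sqsubseteq> s"
  shows "u \<sqsubseteq> s"
proof -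
  define p' where "p' = take (length w) p"
  define r where "r = drop (length w) p"
  have p': "p' \<noteq> []" "length p' = length w" and r: "r \<noteq> []"
    using long nonempty by (auto simp: p'_def r_def)
  obtain x where x: "x \<notin> set p'" using ex_new_if_finite[of "set p'"] by auto
  obtain y where y: "y \<notin> insert x (set p')" using ex_new_if_finite[of "insert x (set p')"] by auto
  let ?s = "Mult (word_trm p') (Var x)" and ?\<sigma> = "Var(x := word_trm r, y := u)"
  have "satisfies (word_semiring {w}) (?s, Add ?s (Var y))"
    unfolding satisfies_Add
  proof (intro allI impI)
    fix v z
    assume v: "range v \<subseteq> alg_carrier (word_semiring {w})"
      and "trm_eval (word_semiring {w}) v ?s = Some z"
    then have z: "z \<in> factors {w}" "spells v (p' @ [x]) z"
      unfolding trm_eval_eq_Some[OF v] by (auto simp: trm_words_word_trm[OF p'(1)])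
    then have "length w < length z" using length_spells[OF v z(2)] p'(2) by simp
    then have False using length_factor[OF z(1)] by simp
    then show "trm_eval (word_semiring {w}) v (Var y) = Some z" ..
  qed
  then have "trm_subst ?\<sigma> ?s \<cong> trm_subst ?\<sigma> (Add ?s (Var y))"
    using length_pos by (rule_tac eqv_small_subst) (auto simp: leaves_word_trm p')
  moreover have "trm_subst ?\<sigma> (word_trm p') = word_trm p'"
  proof -
    have "trm_subst ?\<sigma> (word_trm p') = trm_subst Var (word_trm p')"
      using x y by (intro trm_subst_cong) (auto simp: trm_vars_word_trm[OF p'(1)])
    then show ?thesis by (simp add: trm_subst_Var)
  qed
  ultimately have "u \<sqsubseteq> Mult (word_trm p') (word_trm r)"
    using y by (simp add: below_def)
  then have "u \<sqsubseteq> word_trm (p' @ r)"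
    by (rule below_cong_right[OF _ word_trm_append[OF p'(1) r]])
  then have "u \<sqsubseteq> word_trm p" by (simp add: p'_def r_def)
  then show ?thesis using p by (rule below_trans)
qed

lemma path_system_below:
  assumes short: "\<And>p. p \<noteq> [] \<Longrightarrow> word_trm p \<sqsubseteq> s \<Longrightarrow> length p \<le> length w"
  shows "path_system {p. p \<noteq> [] \<and> word_trm p \<sqsubseteq> s} (length w)"
proof -
  let ?C = "{p. p \<noteq> [] \<and> word_trm p \<sqsubseteq> s}"
  have closed: "q \<in> ?C"
    if C: "p1 \<in> ?C" "p2 \<in> ?C" "p3 \<in> ?C" and len: "length q \<le> 2 * length w"
      and spells: "\<And>v z. range v \<subseteq> alg_carrier (word_semiring {w}) \<Longrightarrow> z \<in> factors {w} \<Longrightarrow>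
        spells v p1 z \<Longrightarrow> spells v p2 z \<Longrightarrow> spells v p3 z \<Longrightarrow> spells v q z"
    for p1 p2 p3 q
  proof (cases "q = []")
    case True
    \<comment> \<open>A conclusion \<open>[]\<close> would spell the empty word, which is not a
      factor. So the premises never share a factor as value and also imply this word, which is one
      letter too long, against \<open>short\<close>.\<close>
    let ?q = "replicate (Suc (length w)) 0"
    have "word_trm ?q \<sqsubseteq> s"
    proof (rule below_consequence[of p1 s p2 p3])
      show "spells v ?q z"
        if "range v \<subseteq> alg_carrier (word_semiring {w})" "z \<in> factors {w}" "spells v p1 z" "spells v p2 z"
          "spells v p3 z" for v z
        using spells[OF that] that(2) Nil_notin_factors by (auto simp: True spells_Nil)
    qed (use C short length_pos in \<open>auto simp: Suc_le_eq\<close>)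
    then show ?thesis using short[of ?q] by simp
  next
    case False
    have "word_trm q \<sqsubseteq> s"
      by (rule below_consequence[of p1 s p2 p3]) (use C short len spells False in auto)
    then show ?thesis using False by simp
  qed
  have ne: "X \<noteq> []" if "range v \<subseteq> alg_carrier (word_semiring {w})" "v x = Some X" for v x X
  proof -
    have "Some X \<in> alg_carrier (word_semiring {w})" using that by (metis rangeI subsetD)
    then show ?thesis using Nil_notin_factors by (auto simp: word_semiring_def)
  qed
  show ?thesis
  proof
    show "length p \<le> length w" if "p \<in> ?C" for p
      using that short by blast
  next
    fix p x r p' r'
    assume C: "p @ x # r \<in> ?C" "p' @ x # r' \<in> ?C"
    have len: "length (p @ x # r') \<le> 2 * length w"
      using short[of "p @ x # r"] short[of "p' @ x # r'"] C by simp
    show "p @ x # r' \<in> ?C"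
    proof (rule closed[OF C C(2) len])
      fix v z
      assume v: "range v \<subseteq> alg_carrier (word_semiring {w})" and z: "z \<in> factors {w}"
        and 1: "spells v (p @ x # r) z" and 2: "spells v (p' @ x # r') z"
      obtain P X R where PR: "spells v p P" "v x = Some X" "z = P @ X @ R"
        using 1 unfolding spells_append spells_Cons by blast
      moreover obtain P' X' R' where "v x = Some X'" "spells v r' R'" "z = P' @ X' @ R'"
        using 2 unfolding spells_append spells_Cons by blast
      ultimately have PR': "spells v r' R'" "z = P' @ X @ R'" by simp_all
      \<comment> \<open>The nonempty value of \<open>x\<close> occurs at only one place in
        \<open>z\<close>, so the same symbols follow it in both decompositions.\<close>
      have "R = R'"
      proof (rule distinct_middle_unique(2))
        show "distinct (P @ X @ R)" using factor_distinct[OF z] unfolding PR(3) .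
        show "P @ X @ R = P' @ X @ R'" using PR(3) PR'(2) by simp
        show "X \<noteq> []" by (rule ne[OF v PR(2)])
      qed
      then show "spells v (p @ x # r') z"
        using PR PR' by (auto simp: spells_append spells_Cons)
    qed
  next
    fix p r p' r'
    assume C: "p @ r \<in> ?C" "p' @ r \<in> ?C" "p' @ r' \<in> ?C"
    have len: "length (p @ r') \<le> 2 * length w"
      using short[of "p @ r"] short[of "p' @ r'"] C by simp
    show "p @ r' \<in> ?C"
    proof (rule closed[OF C len])
      fix v z
      assume "spells v (p @ r) z" "spells v (p' @ r) z" "spells v (p' @ r') z"
      \<comment> \<open>Cancelling the value of \<open>r\<close> shows that \<open>p\<close> and
        \<open>p'\<close> spell the same word; cancelling that one does the same for
        \<open>r\<close> and \<open>r'\<close>.\<close>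
      then show "spells v (p @ r') z"
        unfolding spells_append by (metis append_same_eq same_append_eq spells_unique)
    qed
  next
    fix p r p' r'
    assume C: "p @ r \<in> ?C" "p' @ r' \<in> ?C" and eq: "length p = length p'"
      and full: "length (p @ r) = length w" "length (p' @ r') = length w"
    have len: "length (p @ r') \<le> 2 * length w" using eq full by simp
    show "p @ r' \<in> ?C"
    proof (rule closed[OF C C(2) len])
      fix v z
      assume v: "range v \<subseteq> alg_carrier (word_semiring {w})" and z: "z \<in> factors {w}"
        and "spells v (p @ r) z" "spells v (p' @ r') z"
      then obtain P R P' R' where PR: "spells v p P" "spells v r R" "z = P @ R"
          "spells v p' P'" "spells v r' R'" "z = P' @ R'"
        by (auto simp: spells_append)
      have "length P + length R \<le> length w"
        using length_factor[OF z] unfolding PR(3) length_append .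
      moreover have "length P' + length R' \<le> length w"
        using length_factor[OF z] unfolding PR(6) length_append .
      \<comment> \<open>With \<open>length w\<close> letters in at most \<open>length w\<close>
        symbols, every letter contributes exactly one symbol.\<close>
      ultimately have "length P = length P'"
        using length_spells[OF v PR(1)] length_spells[OF v PR(2)] length_spells[OF v PR(4)]
          length_spells[OF v PR(5)] eq full by simp
      then have "z = P @ R'" using PR(3,6) by simp
      then show "spells v (p @ r') z"
        using PR by (auto simp: spells_append)
    qed
  qed
qed

text \<open>A word longer than \<open>w\<close> below \<open>s\<close> makes \<open>s\<close>
  derivably zero. Otherwise the words of \<open>s\<close> spell one common factor under each
  assignment; this is then the value of \<open>s\<close>, hence of \<open>t\<close>, so every word
  \<open>q\<close> of \<open>t\<close> spells it and lies in \<open>?C\<close>.\<close>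

lemma below_of_satisfies:
  assumes sat: "satisfies (word_semiring {w}) (s, t)"
  shows "t \<sqsubseteq> s"
proof (cases "\<exists>p. p \<noteq> [] \<and> word_trm p \<sqsubseteq> s \<and> length w < length p")
  case True
  then show ?thesis using below_long by blast
next
  case False
  let ?C = "{p. p \<noteq> [] \<and> word_trm p \<sqsubseteq> s}"
  interpret path_system ?C "length w"
    by (rule path_system_below) (use False in \<open>auto simp: not_less\<close>)
  have words: "trm_words s \<subseteq> ?C"
    using word_below trm_words_not_Nil by blast
  obtain r where r: "r \<in> trm_words s" using trm_words_nonempty by (meson all_not_in_conv)
  then have C: "r \<in> ?C" using words by blast
  show ?thesis
  proof (rule below_words)
    fix q assume q: "q \<in> trm_words t"
    have "q \<in> ?C"
    proof (rule memI_spells[OF distinct refl C])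
      fix u r' assume u: "r' \<in> node u"
      let ?v = "assignment w (node u)" and ?z = "slice w (level (node u) (node [])) (length w)"
      have v: "range ?v \<subseteq> alg_carrier (word_semiring {w})" by (rule range_assignment) simp
      \<comment> \<open>The source lies strictly below the sink, so the common value is nonempty and
        thus a factor.\<close>
      have "level (node u) (node []) < level (node u) (node ([] @ r))"
        by (rule level_less[of r "[]"]) (use C in \<open>auto simp: in_node\<close>)
      then have "level (node u) (node []) < length w"
        using level_node[OF C u] by simp
      then have "?z \<in> factors {w}" by (rule slice_in_factors) simp
      moreover have "spells ?v p ?z" if "p \<in> trm_words s" for p
        by (rule spells_assignment_mem[OF distinct refl _ u]) (use words that in blast)
      ultimately have "trm_eval (word_semiring {w}) ?v s = Some ?z"
        unfolding trm_eval_eq_Some[OF v] by blast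
      then have "trm_eval (word_semiring {w}) ?v t = Some ?z"
        using sat v unfolding satisfies_def by simp
      then show "spells ?v q ?z"
        unfolding trm_eval_eq_Some[OF v] using q by blast
    qed
    then show "word_trm q \<sqsubseteq> s" by blast
  qed
qed

lemma finitely_based_word_semiring: "finitely_based (word_semiring {w})"
  unfolding finitely_based_def
proof (intro exI conjI ballI allI impI)
  show "finite (small_identities (word_semiring {w}) (6 * length w + 6))"
    by (rule finite_small_identities)
  show "satisfies (word_semiring {w}) e"
    if "e \<in> small_identities (word_semiring {w}) (6 * length w + 6)" for e
    using that by (auto simp: small_identities_def)
  show "s \<cong> t" if "satisfies (word_semiring {w}) (s, t)" for s t
  proof (rule below_antisym)
    show "t \<sqsubseteq> s" using that by (rule below_of_satisfies)
    show "s \<sqsubseteq> t" using that by (intro below_of_satisfies) (simp add: satisfies_def)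
  qed
qed

end

section \<open>The word with four distinct letters\<close>

lemma factors_four:
  "factors {[a, b, c, d]} = {[a], [b], [c], [d], [a, b], [b, c], [c, d], [a, b, c], [b, c, d], [a, b, c, d]}"
proof -
  have "factors {[a, b, c, d]} = set (sublists [a, b, c, d]) - {[]}"
    unfolding factors_def set_sublists_eq by blast
  then show ?thesis by auto
qed

theorem corollary6p3:
  fixes a b c d :: 'a
  assumes "distinct [a, b, c, d]"
  shows "(flat_semiring (word_semiring {[a, b, c, d]}) \<and>
          card (alg_carrier (word_semiring {[a, b, c, d]})) = 11 \<and>
          \<not> mult_commutative (word_semiring {[a, b, c, d]}) \<and>
          finitely_based (word_semiring {[a, b, c, d]})) \<and>
         \<not> (\<forall>W :: 'a list set. finite W \<and> W \<noteq> {} \<and> [] \<notin> W \<longrightarrow>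
              (finitely_based (word_semiring W) \<longleftrightarrow> (\<forall>w\<in>W. length w \<le> 3))) \<and>
         \<not> (\<forall>W :: 'a list set. W \<noteq> {} \<and> [] \<notin> W \<longrightarrow>
              (finitely_based (word_semiring W) \<longleftrightarrow> (\<forall>w\<in>W. length w \<le> 3)))"
proof -
  let ?W = "{[a, b, c, d]}"
  interpret linear_word "[a, b, c, d]"
    using assms by unfold_locales simp_all
  have fb: "finitely_based (word_semiring ?W)" by (rule finitely_based_word_semiring)
  have "card (alg_carrier (word_semiring ?W)) = Suc (card (factors ?W))"
  proof -
    have "finite (factors ?W)" by (simp add: factors_four)
    then show ?thesis by (simp add: word_semiring_def card_insert_if card_image image_iff)
  qed
  \<comment> \<open>There are 4 + 3 + 2 + 1 factors of lengths 1 to 4.\<close>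
  also have "card (factors ?W) = 10"
    using assms by (simp add: factors_four)
  finally have card: "card (alg_carrier (word_semiring ?W)) = 11" by simp
  have noncomm: "\<not> mult_commutative (word_semiring ?W)"
  proof
    assume "mult_commutative (word_semiring ?W)"
    moreover have "Some [a] \<in> alg_carrier (word_semiring ?W)" "Some [b] \<in> alg_carrier (word_semiring ?W)"
      by (simp_all add: word_semiring_def factors_four)
    ultimately have "alg_mult (word_semiring ?W) (Some [a]) (Some [b]) =
        alg_mult (word_semiring ?W) (Some [b]) (Some [a])"
      unfolding mult_commutative_def by blast
    \<comment> \<open>The word \<open>ab\<close> is a factor, but \<open>ba\<close> is not.\<close>
    then show False using assms by (simp add: word_semiring_def word_mult_Some factors_four)
  qed
  have counterexample: "\<not> (finitely_based (word_semiring ?W) \<longleftrightarrow> (\<forall>w\<in>?W. length w \<le> 3))"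
    using fb by simp
  have W: "finite ?W \<and> ?W \<noteq> {} \<and> [] \<notin> ?W" by simp
  show ?thesis
  proof (intro conjI notI)
    assume "\<forall>W :: 'a list set. finite W \<and> W \<noteq> {} \<and> [] \<notin> W \<longrightarrow>
      (finitely_based (word_semiring W) \<longleftrightarrow> (\<forall>w\<in>W. length w \<le> 3))"
    from mp[OF spec[OF this] W] show False by (rule notE[OF counterexample])
  next
    assume "\<forall>W :: 'a list set. W \<noteq> {} \<and> [] \<notin> W \<longrightarrow>
      (finitely_based (word_semiring W) \<longleftrightarrow> (\<forall>w\<in>W. length w \<le> 3))"
    from mp[OF spec[OF this] conjunct2[OF W]] show False by (rule notE[OF counterexample])
  qed (use noncomm in \<open>simp_all add: flat_semiring_word_semiring card fb\<close>)
qed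

end
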